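(* Let $n\ge1$, $k\ge0$ be integers with $2k\le 3n$, and let $\mathcal P$ be the set of all pairs $(T^+,T^-)$ of standard tableaux obtained (as in the context) from semistandard tableaux $T$ of shape $(3^n)$ and type $\{1^2,\dots,k^2,k+1,\dots,3n-k\}$. To $(T^+,T^-)\in\mathcal P$ associate the $\mathsf{A}_2$ flow diagram of the word $w=w_1\cdots w_{3n-k}$ in $\{\pm1,\pm2,\pm3\}$ given by $w_i=-r$ if $1\le i\le 3n-2k$ and $i$ lies in row $r$ of $T^-$, and $w_{3n-k+1-i}=r$ if $1\le i\le k$ and $i$ lies in row $r$ of $T^+$. Then this flow diagram is admissible, and the map sending $(T^+,T^-)$ to this flow diagram is a bijection from $\mathcal P$ onto the set of admissible $\mathsf{A}_2$ flow diagrams whose word has sign string consisting of $3n-2k$ minuses followed by $k$ pluses.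
   Context: **Tableaux.** The shape $(3^n)$ has $n$ rows of 3 boxes. Type $\{1^2,\dots,k^2,k+1,\dots,3n-k\}$ means that each of $1,\dots,k$ occurs twice and each of $k+1,\dots,3n-k$ occurs once; semistandard means rows weakly increase and columns strictly increase. Given $T$, let $T_1$ be the subtableau formed by the entries $\le k$ and $T_2$ the skew subtableau formed by the entries $>k$. For $r=1,2,3$, row $r$ of $T^+$ lists in increasing order the elements of $\{1,\dots,k\}$ that do not occur in column $4-r$ of $T_1$; row $r$ of $T^-$ lists in increasing order the numbers $3n-k+1-x$ for $x$ an entry of $T_2$ in column $4-r$. Both are standard tableaux with at most three rows. **$\mathsf{A}_2$ flow diagrams (case $r=3$ of Westbury's flow diagrams).** Let $w=w_1\cdots w_N$ be a word in $\{\pm1,\pm2,\pm3\}$; its sign string has $i$th symbol $+$ if $w_i>0$ and $-$ if $w_i<0$. The flow diagram of $w$ is an edge labeling of a downward-pointing equilateral triangle of side $N$, tiled by $N$ downward-pointing unit triangles along the top side and, below these, successive rows of $N-1,N-2,\dots,1$ unit rhombi (each with top-left, top-right, bottom-left and bottom-right edges). Edges carry flows in $\mathbb Z/3$, where reversing the direction of an edge negates its label; an edge with label $0$ (equivalently $3$) is regarded as absent. The labels are determined as follows. - Unit triangles. If $w_i=-a$ with $a\in\{1,2,3\}$, the $i$th unit triangle has flow $1$ entering through its top edge, flow $a-1$ entering through its left edge (directed upward), and flow $a$ leaving through its right edge (directed downward). If $w_i=a$, it has flow $1$ leaving through its top edge, flow $a$ entering through its left edge (directed upward), and flow $a-1$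 leaving through its right edge (directed downward). All labels are read mod $3$. - Rhombi. Suppose a rhombus has flow $s$ entering through its top-left edge (directed downward) and flow $t$ leaving through its top-right edge (directed upward), with $s,t\in\{0,1,2\}$. If $s=t$, the two top edges are connected to each other inside the rhombus and both bottom edges carry $0$. If $s\ne t$, the two flows cross: flow $s$ leaves through the bottom-right edge (directed downward) and flow $t$ enters through the bottom-left edge (directed upward). Labels on shared edges of adjacent tiles match, so $w$ determines the diagram. The word $w$ (or its flow diagram) is admissible if the flow diagram has no contact with the boundary of the large triangle other than along its top side, i.e. all unit edges on the left and right sides of the large triangle carry label $0$. *)

theory Defs
  imports Main "HOL-Library.Numeral_Type"
begin

text \<open>
  A tableau is the list of its rows, top to bottom. Rows and columns are numbered from 1.
  Trailing empty rows are allowed, so that a standard tableau with at most three rows can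
  always be given by exactly three lists.
\<close>

type_synonym tableau = "nat list list"

definition column :: "nat \<Rightarrow> tableau \<Rightarrow> nat list" where
  "column c T = map (\<lambda>row. row ! (c - 1)) (filter (\<lambda>row. c \<le> length row) T)"

definition semistandard :: "tableau \<Rightarrow> bool" where
  "semistandard T \<longleftrightarrow> (\<forall>row \<in> set T. sorted row) \<and> (\<forall>c \<ge> 1. sorted_wrt (<) (column c T))"

definition has_shape_3n :: "nat \<Rightarrow> tableau \<Rightarrow> bool" where
  "has_shape_3n n T \<longleftrightarrow> map length T = replicate n 3"

definition has_type :: "nat \<Rightarrow> nat \<Rightarrow> tableau \<Rightarrow> bool" where
  "has_type n k T \<longleftrightarrow> (\<forall>x. count_list (concat T) x =
     (if 1 \<le> x \<and> x \<le> k then 2 else if k < x \<and> x \<le> 3 * n - k then 1 else 0))"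

text \<open>The part of a column of \<open>T\<close> lying in \<open>T\<^sub>1\<close> (entries \<open>\<le> k\<close>), respectively \<open>T\<^sub>2\<close> (entries \<open>> k\<close>).\<close>

definition column1 :: "nat \<Rightarrow> nat \<Rightarrow> tableau \<Rightarrow> nat list" where
  "column1 k c T = filter (\<lambda>x. x \<le> k) (column c T)"

definition column2 :: "nat \<Rightarrow> nat \<Rightarrow> tableau \<Rightarrow> nat list" where
  "column2 k c T = filter (\<lambda>x. k < x) (column c T)"

definition T_plus :: "nat \<Rightarrow> tableau \<Rightarrow> tableau" where
  "T_plus k T = map (\<lambda>r. filter (\<lambda>x. x \<notin> set (column1 k (4 - r) T)) [1..<Suc k]) [1, 2, 3]"

definition T_minus :: "nat \<Rightarrow> nat \<Rightarrow> tableau \<Rightarrow> tableau" where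
  "T_minus n k T =
     map (\<lambda>r. sort (map (\<lambda>x. 3 * n - k + 1 - x) (column2 k (4 - r) T))) [1, 2, 3]"

definition tableau_pairs :: "nat \<Rightarrow> nat \<Rightarrow> (tableau \<times> tableau) set" where
  "tableau_pairs n k =
     {(T_plus k T, T_minus n k T) | T. has_shape_3n n T \<and> semistandard T \<and> has_type n k T}"

definition row_of :: "tableau \<Rightarrow> nat \<Rightarrow> nat" where
  "row_of P i = (THE r. 1 \<le> r \<and> r \<le> length P \<and> i \<in> set (P ! (r - 1)))"

definition pair_word :: "nat \<Rightarrow> nat \<Rightarrow> tableau \<times> tableau \<Rightarrow> int list" where
  "pair_word n k = (\<lambda>(P, M).
     map (\<lambda>i. - int (row_of M i)) [1..<Suc (3 * n - 2 * k)] @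
     rev (map (\<lambda>i. int (row_of P i)) [1..<Suc k]))"

definition letters :: "int set" where
  "letters = {1, 2, 3, -1, -2, -3}"

text \<open>The sign \<open>+\<close> is represented by \<open>1\<close> and the sign \<open>-\<close> by \<open>-1\<close>.\<close>

definition sign_string :: "int list \<Rightarrow> int list" where
  "sign_string w = map sgn w"

text \<open>
  Flows take values in the ring \<open>3\<close> of integers modulo 3. Every edge gets a fixed reference
  direction: top edges downward (entering the triangle), edges parallel to the left side of the
  large triangle upward, edges parallel to its right side downward. These are the directions used
  in the tile rules, except that a flow leaving through a top edge gets a minus sign.
\<close>

definition triangle_top :: "int \<Rightarrow> 3" where
  "triangle_top a = (if a < 0 then 1 else - 1)"

definition triangle_left :: "int \<Rightarrow> 3" where
  "triangle_left a = (if a < 0 then of_int (- a - 1) else of_int a)"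

definition triangle_right :: "int \<Rightarrow> 3" where
  "triangle_right a = (if a < 0 then of_int (- a) else of_int (a - 1))"

text \<open>From the top-left and top-right labels of a rhombus to its bottom-left and bottom-right labels.\<close>

definition rhombus :: "3 \<Rightarrow> 3 \<Rightarrow> 3 \<times> 3" where
  "rhombus s t = (if s = t then (0, 0) else (t, s))"

text \<open>
  \<open>flow_level w 0 i\<close> is the pair of labels of the left and right edge of the \<open>i\<close>th unit triangle;
  \<open>flow_level w j i\<close> for \<open>j > 0\<close> is the pair of labels of the bottom-left and bottom-right edge of
  the \<open>i\<close>th rhombus in the \<open>j\<close>th row of rhombi, where \<open>1 \<le> i \<le> N - j\<close>. The top-left edge of that
  rhombus is the (bottom-)right edge of the \<open>i\<close>th tile in the row above it, its top-right edge the
  (bottom-)left edge of the \<open>i + 1\<close>st one.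
\<close>

fun flow_level :: "int list \<Rightarrow> nat \<Rightarrow> nat \<Rightarrow> 3 \<times> 3" where
  "flow_level w 0 i = (triangle_left (w ! (i - 1)), triangle_right (w ! (i - 1)))"
| "flow_level w (Suc j) i = rhombus (snd (flow_level w j i)) (fst (flow_level w j (Suc i)))"

text \<open>
  \<open>Top_Edge i\<close> is the top edge of the \<open>i\<close>th unit triangle; \<open>Left_Edge j i\<close> and \<open>Right_Edge j i\<close> are
  the edges described by \<open>flow_level w j i\<close>. These are all edges of the tiling, each occurring once.
\<close>

datatype edge = Top_Edge nat | Left_Edge nat nat | Right_Edge nat nat

fun is_edge :: "nat \<Rightarrow> edge \<Rightarrow> bool" where
  "is_edge N (Top_Edge i) \<longleftrightarrow> 1 \<le> i \<and> i \<le> N"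
| "is_edge N (Left_Edge j i) \<longleftrightarrow> j < N \<and> 1 \<le> i \<and> i \<le> N - j"
| "is_edge N (Right_Edge j i) \<longleftrightarrow> j < N \<and> 1 \<le> i \<and> i \<le> N - j"

fun flow_label :: "int list \<Rightarrow> edge \<Rightarrow> 3" where
  "flow_label w (Top_Edge i) = triangle_top (w ! (i - 1))"
| "flow_label w (Left_Edge j i) = fst (flow_level w j i)"
| "flow_label w (Right_Edge j i) = snd (flow_level w j i)"

text \<open>A diagram is a labeling defined exactly on the edges of the tiled triangle of side \<open>N\<close>.\<close>

type_synonym diagram = "edge \<Rightarrow> 3 option"

definition flow_diagram :: "int list \<Rightarrow> diagram" where
  "flow_diagram w = (\<lambda>e. if is_edge (length w) e then Some (flow_label w e) else None)"

text \<open>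
  The left side of the large triangle consists of the edges \<open>Left_Edge j 1\<close>, the right side of the
  edges \<open>Right_Edge j (N - j)\<close>, where \<open>j < N\<close>.
\<close>

definition admissible :: "int list \<Rightarrow> bool" where
  "admissible w \<longleftrightarrow> (\<forall>j < length w.
     flow_diagram w (Left_Edge j 1) = Some 0 \<and>
     flow_diagram w (Right_Edge j (length w - j)) = Some 0)"

definition admissible_diagrams :: "nat \<Rightarrow> nat \<Rightarrow> diagram set" where
  "admissible_diagrams n k =
     {flow_diagram w | w. set w \<subseteq> letters \<and>
        sign_string w = replicate (3 * n - 2 * k) (- 1) @ replicate k 1 \<and>
        admissible w}"

end

theory Submission
  imports Defs
begin

text \<open>
  Put \<open>N = 3n - k\<close>. A tableau with strictly increasing columns is determined by the three sets
  \<open>C 1\<close>, \<open>C 2\<close>, \<open>C 3\<close> of its column entries, and so is a word with the prescribed sign string: its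
  letter in position \<open>N + 1 - x\<close> tells, for a minus, which column contains \<open>x\<close>, and for a plus,
  which column omits \<open>x\<close>. The type of the tableau says that \<open>x\<close> lies in two columns if \<open>x \<le> k\<close>
  and in one otherwise, which is exactly what a letter with the right sign encodes
  (\<open>family_word_inverse\<close>, \<open>word_family_inverse\<close>). The word attached to \<open>(T\<^sup>+, T\<^sup>-)\<close> is the word of
  the columns of \<open>T\<close> (\<open>pair_word_eq\<close>), so what has to be shown is that the same families \<open>C\<close> come
  from tableaux and from admissible words.

  On the tableau side, if all columns have size \<open>n\<close>, the rows are weakly increasing iff, for every \<open>x\<close>, the number of entries above \<open>x\<close> weakly increases from each column to the next
  (\<open>pointwise_le_iff_card_greater\<close>).

  On the diagram side, two flows annihilate in a rhombus if they are equal and pass through each other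
  otherwise. So the flow \<open>d \<in> {1, 2}\<close> behaves like a parenthesis of colour \<open>d\<close>: on the right edge of a
  unit triangle it is an opening one, on the left edge a closing one, and colours do not interact.
  The diagram misses the left and right sides iff both coloured parenthesis words are balanced
  (\<open>admissible_iff_height\<close>). The proof of this rests on conservation: in every
  rhombus as many of the two left-hand edges as of the two right-hand edges carry the label \<open>d\<close>.

  The two conditions agree: reading the word up to the letter of \<open>x + 1\<close>, the excess of opening over
  closing parentheses of colour \<open>1\<close> is the number of entries above \<open>x\<close> in column 3 minus that
  in column 2, and for colour \<open>2\<close> the same holds with columns 2 and 1 (\<open>height_family_word\<close>). Balance
  thus means that the counts are weakly increasing and that the three columns have equal size;
  this size is \<open>n\<close> because there are \<open>3n\<close> entries in all.
\<close>

section \<open>Flows as coloured parentheses\<close>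

lemma exhaust_mod3: "x = 0 \<or> x = 1 \<or> x = (2 :: 3)"
proof (induct x)
  case (of_int z)
  then have "z = 0 \<or> z = 1 \<or> z = 2" by auto
  then show ?case by auto
qed

text \<open>
  The tile in which the strips of the letters \<open>i\<close> and \<open>m\<close> cross is indexed here by the pair \<open>(i, m)\<close>. In these
  coordinates the right edges with fixed \<open>i\<close> form the path of the flow that starts at letter \<open>i\<close> towards
  the lower right, and the left edges with fixed \<open>m\<close> the path of the flow at letter \<open>m\<close> towards the
  lower left.
\<close>
definition left_flow :: "int list \<Rightarrow> nat \<Rightarrow> nat \<Rightarrow> 3" where
  "left_flow w i m = fst (flow_level w (m - i) i)"

definition right_flow :: "int list \<Rightarrow> nat \<Rightarrow> nat \<Rightarrow> 3" where
  "right_flow w i m = snd (flow_level w (m - i) i)"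

lemma flow_unit_triangle:
  "left_flow w m m = triangle_left (w ! (m - 1))"
  "right_flow w m m = triangle_right (w ! (m - 1))"
  by (simp_all add: left_flow_def right_flow_def)

lemma flow_rhombus:
  assumes "i \<le> m"
  shows "(left_flow w i (Suc m), right_flow w i (Suc m)) =
    rhombus (right_flow w i m) (left_flow w (Suc i) (Suc m))"
  using assms by (simp add: left_flow_def right_flow_def Suc_diff_le)

lemma admissible_iff_sides:
  "admissible w \<longleftrightarrow> (\<forall>m \<in> {1..length w}. left_flow w 1 m = 0) \<and>
     (\<forall>i \<in> {1..length w}. right_flow w i (length w) = 0)"
proof -
  let ?N = "length w"
  have "(\<forall>j < ?N. fst (flow_level w j 1) = 0) \<longleftrightarrow> (\<forall>m \<in> {1..?N}. left_flow w 1 m = 0)"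
    unfolding left_flow_def
    by (metis (no_types, lifting) Suc_le_eq Suc_le_lessD add_diff_cancel_left' atLeastAtMost_iff
        le_add1 le_add_diff_inverse plus_1_eq_Suc)
  moreover have "(\<forall>j < ?N. snd (flow_level w j (?N - j)) = 0) \<longleftrightarrow>
      (\<forall>i \<in> {1..?N}. right_flow w i ?N = 0)"
  proof
    assume L: "\<forall>j < ?N. snd (flow_level w j (?N - j)) = 0"
    show "\<forall>i \<in> {1..?N}. right_flow w i ?N = 0"
    proof
      fix i assume "i \<in> {1..?N}"
      then have "?N - i < ?N" "?N - (?N - i) = i" by auto
      then show "right_flow w i ?N = 0" using L unfolding right_flow_def by metis
    qed
  next
    assume R: "\<forall>i \<in> {1..?N}. right_flow w i ?N = 0"
    show "\<forall>j < ?N. snd (flow_level w j (?N - j)) = 0"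
    proof (intro allI impI)
      fix j assume "j < ?N"
      then have "?N - j \<in> {1..?N}" "?N - (?N - j) = j" by auto
      then show "snd (flow_level w j (?N - j)) = 0" using R unfolding right_flow_def by metis
    qed
  qed
  ultimately show ?thesis
    unfolding admissible_def flow_diagram_def by auto
qed

definition height :: "int list \<Rightarrow> 3 \<Rightarrow> nat \<Rightarrow> int" where
  "height w d m =
     (\<Sum>q < m. of_bool (triangle_right (w ! q) = d) - of_bool (triangle_left (w ! q) = d))"

definition open_flows :: "int list \<Rightarrow> 3 \<Rightarrow> nat \<Rightarrow> int" where
  "open_flows w d m = (\<Sum>i = 1..m. of_bool (right_flow w i m = d))"

text \<open>
  Conservation of the flow \<open>d\<close> in each rhombus of the strip of letter \<open>m + 1\<close>: the left edges
  telescope along the strip, so that only its first left edge, on the side of the large triangle, and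
  its last one, in the unit triangle, survive.
\<close>
lemma open_flows_Suc:
  assumes "d \<noteq> 0"
  shows "open_flows w d (Suc m) = open_flows w d m
     + of_bool (triangle_right (w ! m) = d) - of_bool (triangle_left (w ! m) = d)
     + of_bool (left_flow w 1 (Suc m) = d)"
proof -
  let ?L = "\<lambda>i. of_bool (left_flow w i (Suc m) = d) :: int"
  have rh: "of_bool (right_flow w i (Suc m) = d) =
      of_bool (right_flow w i m = d) + (?L i - ?L (Suc i))" if "i \<in> {1..m}" for i
    using flow_rhombus[of i m w] that assms by (auto simp: rhombus_def split: if_splits)
  have tele: "(\<Sum>i = 1..m. f i - f (Suc i)) = f 1 - f (Suc m)" for f :: "nat \<Rightarrow> int"
    by (induction m) auto
  have "open_flows w d (Suc m) = of_bool (triangle_right (w ! m) = d) +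
      (\<Sum>i = 1..m. of_bool (right_flow w i (Suc m) = d))"
    by (simp add: open_flows_def flow_unit_triangle)
  also have "(\<Sum>i = 1..m. of_bool (right_flow w i (Suc m) = d)) =
      open_flows w d m + (\<Sum>i = 1..m. ?L i - ?L (Suc i))"
    by (simp only: rh open_flows_def sum.distrib cong: sum.cong)
  also have "(\<Sum>i = 1..m. ?L i - ?L (Suc i)) = ?L 1 - of_bool (triangle_left (w ! m) = d)"
    using tele[of ?L] by (simp add: flow_unit_triangle)
  finally show ?thesis by simp
qed

lemma open_flows_eq_height:
  assumes "d \<noteq> 0" and "\<forall>j \<in> {1..m}. left_flow w 1 j \<noteq> d"
  shows "open_flows w d m = height w d m"
  using assms(2)
proof (induction m)
  case 0
  show ?case by (simp add: open_flows_def height_def)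
next
  case (Suc m)
  then show ?case using open_flows_Suc[OF assms(1), of w m] by (simp add: height_def)
qed

text \<open>
  A flow that reaches the left side of the large triangle has met no equal flow on its way: a closing
  parenthesis stays unmatched only if no opening one is available.
\<close>
lemma left_flow_undisturbed:
  assumes "left_flow w 1 (Suc m) = d" and "d \<noteq> 0"
  shows "triangle_left (w ! m) = d" and "open_flows w d m = 0"
proof -
  have *: "left_flow w (Suc i) (Suc m) = d \<and> (\<forall>j \<in> {1..i}. right_flow w j m \<noteq> d)" if "i \<le> m" for i
    using that
  proof (induction i)
    case 0
    then show ?case using assms by simp
  next
    case (Suc i)
    then have "left_flow w (Suc i) (Suc m) = d" by simp
    then have "left_flow w (Suc (Suc i)) (Suc m) = d \<and> right_flow w (Suc i) m \<noteq> d"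
      using flow_rhombus[of "Suc i" m w] Suc.prems assms(2)
      by (auto simp: rhombus_def split: if_splits)
    then show ?case using Suc by (auto simp: le_Suc_eq)
  qed
  show "triangle_left (w ! m) = d" using *[of m] by (simp add: flow_unit_triangle)
  show "open_flows w d m = 0" using *[of m] by (simp add: open_flows_def)
qed

lemma triangle_left_neq_right:
  assumes "a \<in> letters" shows "triangle_left a \<noteq> triangle_right a"
  using assms by (auto simp: letters_def triangle_left_def triangle_right_def)

text \<open>
  As long as no flow has reached the left side, the height counts the flows still travelling to the
  right, so it is nonnegative, and those left at the end are the ones that reach the right side.
  Conversely, the first flow to reach the left side would make the height \<open>-1\<close>.
\<close>
lemma admissible_iff_height:
  assumes "set w \<subseteq> letters"
  shows "admissible w \<longleftrightarrow>
    (\<forall>d. d \<noteq> 0 \<longrightarrow> (\<forall>m \<le> length w. 0 \<le> height w d m) \<and> height w d (length w) = 0)"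
proof
  assume "admissible w"
  then have L: "\<forall>m \<in> {1..length w}. left_flow w 1 m = 0"
    and R: "\<forall>i \<in> {1..length w}. right_flow w i (length w) = 0"
    unfolding admissible_iff_sides by auto
  show "\<forall>d. d \<noteq> 0 \<longrightarrow> (\<forall>m \<le> length w. 0 \<le> height w d m) \<and> height w d (length w) = 0"
  proof (intro allI impI)
    fix d :: 3 assume d: "d \<noteq> 0"
    have eq: "open_flows w d m = height w d m" if "m \<le> length w" for m
      using open_flows_eq_height[of d m w] L d that by fastforce
    have "0 \<le> height w d m" if "m \<le> length w" for m
      unfolding eq[OF that, symmetric] by (simp add: open_flows_def sum_nonneg)
    moreover have "height w d (length w) = 0"
      unfolding eq[OF order_refl, symmetric] using R d by (simp add: open_flows_def)
    ultimately show "(\<forall>m \<le> length w. 0 \<le> height w d m) \<and> height w d (length w) = 0" by simp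
  qed
next
  assume H: "\<forall>d. d \<noteq> 0 \<longrightarrow> (\<forall>m \<le> length w. 0 \<le> height w d m) \<and> height w d (length w) = 0"
  have L: "m \<in> {1..length w} \<Longrightarrow> left_flow w 1 m = 0" for m
  proof (induction m rule: less_induct)
    case (less m)
    show ?case
    proof (rule ccontr)
      define d where "d = left_flow w 1 m"
      assume "left_flow w 1 m \<noteq> 0"
      then have d: "d \<noteq> 0" by (simp add: d_def)
      obtain p where p: "m = Suc p" using less.prems by (cases m) auto
      have left: "triangle_left (w ! p) = d" and "open_flows w d p = 0"
        using left_flow_undisturbed[of w p d] d by (simp_all add: d_def p)
      moreover have "open_flows w d p = height w d p"
        using less d by (intro open_flows_eq_height) (auto simp: p)
      moreover have "w ! p \<in> letters"
        using assms less.prems nth_mem[of p w] by (auto simp: p)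
      then have "triangle_right (w ! p) \<noteq> d" using triangle_left_neq_right left by metis
      ultimately have "height w d m = - 1" by (simp add: height_def p)
      then show False using H d less.prems by fastforce
    qed
  qed
  moreover have "right_flow w i (length w) = 0" if "i \<in> {1..length w}" for i
  proof (rule ccontr)
    define d where "d = right_flow w i (length w)"
    assume "right_flow w i (length w) \<noteq> 0"
    then have d: "d \<noteq> 0" by (simp add: d_def)
    have "open_flows w d (length w) = height w d (length w)"
      using L d by (intro open_flows_eq_height) auto
    then have "open_flows w d (length w) = 0" using H d by simp
    then have "\<forall>j \<in> {1..length w}. of_bool (right_flow w j (length w) = d) = (0 :: int)"
      unfolding open_flows_def by (subst (asm) sum_nonneg_eq_0_iff) auto
    then show False using that by (auto simp: d_def)
  qed
  ultimately show "admissible w" unfolding admissible_iff_sides by blast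
qed

text \<open>
  The labels of the top and left edges of a unit triangle already determine its letter: the top label
  gives the sign, and with known sign the left label gives the absolute value modulo 3.
\<close>
lemma flow_diagram_inj:
  assumes "flow_diagram v = flow_diagram w" and "set v \<subseteq> letters" and "set w \<subseteq> letters"
  shows "v = w"
proof -
  have dom: "is_edge (length v) e = is_edge (length w) e" for e
    using fun_cong[OF assms(1), of e] by (simp add: flow_diagram_def split: if_splits)
  have len: "length v = length w"
    using dom[of "Top_Edge (length v)"] dom[of "Top_Edge (length w)"] by auto
  show ?thesis
  proof (rule nth_equalityI[OF len])
    fix q assume q: "q < length v"
    have lab: "flow_label v e = flow_label w e" if "is_edge (length v) e" for e
      using fun_cong[OF assms(1), of e] that len by (simp add: flow_diagram_def)
    have "triangle_top (v ! q) = triangle_top (w ! q)"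
      using lab[of "Top_Edge (Suc q)"] q by simp
    moreover have "triangle_left (v ! q) = triangle_left (w ! q)"
      using lab[of "Left_Edge 0 (Suc q)"] q by (cases "v = []") auto
    moreover have "v ! q \<in> letters" "w ! q \<in> letters"
      using assms(2,3) q len nth_mem by (metis subsetD)+
    ultimately show "v ! q = w ! q"
      by (auto simp: letters_def triangle_top_def triangle_left_def)
  qed
qed

section \<open>Tableaux as families of columns\<close>

lemma card_greater_nth:
  fixes xs :: "nat list"
  assumes "distinct xs"
  shows "card {y \<in> set xs. x < y} = card {i. i < length xs \<and> x < xs ! i}"
proof -
  have "{y \<in> set xs. x < y} = (!) xs ` {i. i < length xs \<and> x < xs ! i}"
    by (auto simp: in_set_conv_nth)
  moreover have "inj_on ((!) xs) {i. i < length xs \<and> x < xs ! i}"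
    using assms by (auto intro: inj_on_subset[OF inj_on_nth])
  ultimately show ?thesis by (simp add: card_image)
qed

text \<open>
  This turns the row condition between adjacent columns into one that no longer mentions positions.
  If \<open>ys ! i < xs ! i\<close>, then all entries of \<open>xs\<close> from position \<open>i\<close> on exceed \<open>ys ! i\<close>, but only those of
  \<open>ys\<close> after position \<open>i\<close> do.
\<close>
lemma pointwise_le_iff_card_greater:
  fixes xs ys :: "nat list"
  assumes xs: "sorted_wrt (<) xs" and ys: "sorted_wrt (<) ys" and len: "length xs = length ys"
  shows "(\<forall>i < length xs. xs ! i \<le> ys ! i) \<longleftrightarrow>
    (\<forall>x. card {y \<in> set xs. x < y} \<le> card {y \<in> set ys. x < y})"
    (is "?P \<longleftrightarrow> ?Q")
proof
  assume ?P
  show ?Q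
  proof
    fix x
    have "{i. i < length xs \<and> x < xs ! i} \<subseteq> {i. i < length ys \<and> x < ys ! i}"
      using \<open>?P\<close> len less_le_trans by auto
    then show "card {y \<in> set xs. x < y} \<le> card {y \<in> set ys. x < y}"
      using xs ys by (simp add: card_greater_nth strict_sorted_iff card_mono)
  qed
next
  assume Q: ?Q
  show ?P
  proof (rule ccontr)
    assume "\<not> ?P"
    then obtain i where i: "i < length xs" "ys ! i < xs ! i" by (auto simp: not_le)
    have "{i..<length xs} \<subseteq> {j. j < length xs \<and> ys ! i < xs ! j}"
      using i xs sorted_wrt_nth_less[OF xs, of i] by (force simp: le_less)
    then have "length xs - i \<le> card {j. j < length xs \<and> ys ! i < xs ! j}"
      using card_mono[of "{j. j < length xs \<and> ys ! i < xs ! j}" "{i..<length xs}"] by simp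
    moreover have "{j. j < length ys \<and> ys ! i < ys ! j} \<subseteq> {Suc i..<length xs}"
    proof
      fix j assume j: "j \<in> {j. j < length ys \<and> ys ! i < ys ! j}"
      have "\<not> j \<le> i"
      proof
        assume "j \<le> i"
        then have "ys ! j \<le> ys ! i"
          using sorted_wrt_nth_less[OF ys, of j i] i len by (cases "j = i") auto
        then show False using j by simp
      qed
      then show "j \<in> {Suc i..<length xs}" using j len by simp
    qed
    then have "card {j. j < length ys \<and> ys ! i < ys ! j} \<le> length xs - Suc i"
      using card_mono[of "{Suc i..<length xs}" "{j. j < length ys \<and> ys ! i < ys ! j}"] by simp
    moreover have "card {j. j < length xs \<and> ys ! i < xs ! j}
        \<le> card {j. j < length ys \<and> ys ! i < ys ! j}"
      using Q[rule_format, of "ys ! i"] xs ys by (simp add: card_greater_nth strict_sorted_iff)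
    ultimately show False using i by linarith
  qed
qed

definition column_set :: "tableau \<Rightarrow> nat \<Rightarrow> nat set" where
  "column_set T c = set (column c T)"

text \<open>
  The requirements on the columns are split in two: the first definition below is what every word with the
  prescribed sign string satisfies, the second what characterizes admissibility.
\<close>
definition column_family :: "nat \<Rightarrow> nat \<Rightarrow> (nat \<Rightarrow> nat set) \<Rightarrow> bool" where
  "column_family n k C \<longleftrightarrow>
     (\<forall>c \<in> {1, 2, 3}. C c \<subseteq> {1..3 * n - k}) \<and>
     (\<forall>x \<in> {1..3 * n - k}. of_bool (x \<in> C 1) + of_bool (x \<in> C 2) + of_bool (x \<in> C 3) =
        (if x \<le> k then 2 else 1 :: nat))"

definition dominated :: "nat \<Rightarrow> (nat \<Rightarrow> nat set) \<Rightarrow> bool" where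
  "dominated n C \<longleftrightarrow> (\<forall>c \<in> {1, 2, 3}. card (C c) = n) \<and>
     (\<forall>x. card {y \<in> C 1. x < y} \<le> card {y \<in> C 2. x < y} \<and>
          card {y \<in> C 2. x < y} \<le> card {y \<in> C 3. x < y})"

lemma column_shape:
  assumes "has_shape_3n n T"
  shows "c \<in> {1, 2, 3} \<Longrightarrow> column c T = map (\<lambda>row. row ! (c - 1)) T"
    and "3 < c \<Longrightarrow> column c T = []"
    and "length T = n" and "row \<in> set T \<Longrightarrow> length row = 3"
proof -
  have L: "length row = 3" if "row \<in> set T" for row
    using assms that unfolding has_shape_3n_def
    by (metis in_set_replicate list.set_map image_eqI)
  then show "row \<in> set T \<Longrightarrow> length row = 3" .
  show "length T = n"
    using assms unfolding has_shape_3n_def by (metis length_map length_replicate)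
  show "column c T = map (\<lambda>row. row ! (c - 1)) T" if "c \<in> {1, 2, 3}"
    using L that unfolding column_def by (subst filter_True) auto
  show "column c T = []" if "3 < c"
    using L that unfolding column_def by (subst filter_False) auto
qed

lemma list_of_length_3: "length r = 3 \<Longrightarrow> r = [r ! 0, r ! 1, r ! 2]"
  by (auto simp: length_Suc_conv numeral_3_eq_3)

lemma count_concat:
  assumes "\<forall>row \<in> set T. length row = 3"
  shows "count_list (concat T) x = (\<Sum>c \<in> {1, 2, 3}. count_list (map (\<lambda>row. row ! (c - 1)) T) x)"
  using assms
proof (induction T)
  case (Cons r T)
  obtain a b c where "r = [a, b, c]" using list_of_length_3[of r] Cons.prems by auto
  then show ?case using Cons by (simp add: count_list_append)
qed simp

lemma semistandard_iff:
  assumes "has_shape_3n n T"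
  shows "semistandard T \<longleftrightarrow> (\<forall>c \<in> {1, 2, 3}. sorted_wrt (<) (column c T)) \<and>
    (\<forall>i < n. column 1 T ! i \<le> column 2 T ! i) \<and> (\<forall>i < n. column 2 T ! i \<le> column 3 T ! i)"
proof -
  have rows: "(\<forall>row \<in> set T. sorted row) \<longleftrightarrow>
     (\<forall>i < n. T ! i ! 0 \<le> T ! i ! 1 \<and> T ! i ! 1 \<le> T ! i ! 2)"
  proof -
    have "sorted r \<longleftrightarrow> r ! 0 \<le> r ! 1 \<and> r ! 1 \<le> r ! 2" if "r \<in> set T" for r
      by (subst list_of_length_3[OF column_shape(4)[OF assms that]]) auto
    then show ?thesis using column_shape(3)[OF assms]
      by (auto simp: all_set_conv_all_nth)
  qed
  have cols: "(\<forall>c \<ge> 1. sorted_wrt (<) (column c T)) \<longleftrightarrow>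
     (\<forall>c \<in> {1, 2, 3}. sorted_wrt (<) (column c T))"
  proof -
    have "c \<in> {1, 2, 3} \<or> 3 < c" if "1 \<le> c" for c :: nat using that by auto
    then show ?thesis using column_shape(2)[OF assms] by fastforce
  qed
  show ?thesis
    unfolding semistandard_def rows cols
    using column_shape(1,3)[OF assms] by auto
qed

lemma count_list_distinct:
  "distinct xs \<Longrightarrow> count_list xs x = of_bool (x \<in> set xs)"
  by (induction xs) auto

lemma has_type_iff:
  assumes "has_shape_3n n T" and "\<forall>c \<in> {1, 2, 3}. distinct (column c T)" and "2 * k \<le> 3 * n"
  shows "has_type n k T \<longleftrightarrow> column_family n k (column_set T)"
proof -
  let ?C = "column_set T"
  let ?s = "\<lambda>x. of_bool (x \<in> ?C 1) + of_bool (x \<in> ?C 2) + of_bool (x \<in> ?C 3) :: nat"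
  have "count_list (column c T) x = of_bool (x \<in> ?C c)" if "c \<in> {1, 2, 3}" for c x
    unfolding column_set_def using assms(2) that by (intro count_list_distinct) blast
  then have "count_list (concat T) x = ?s x" for x
    using count_concat[of T x] column_shape(4)[OF assms(1)] column_shape(1)[OF assms(1)] by simp
  then have "has_type n k T \<longleftrightarrow>
      (\<forall>x. ?s x = (if 1 \<le> x \<and> x \<le> k then 2 else if k < x \<and> x \<le> 3 * n - k then 1 else 0))"
    by (simp add: has_type_def)
  also have "\<dots> \<longleftrightarrow> (\<forall>x. if x \<in> {1..3 * n - k} then ?s x = (if x \<le> k then 2 else 1)
      else x \<notin> ?C 1 \<and> x \<notin> ?C 2 \<and> x \<notin> ?C 3)"
    using assms(3) by (intro all_cong1) auto
  also have "\<dots> \<longleftrightarrow>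
      (\<forall>x. x \<notin> {1..3 * n - k} \<longrightarrow> x \<notin> ?C 1 \<and> x \<notin> ?C 2 \<and> x \<notin> ?C 3) \<and>
      (\<forall>x \<in> {1..3 * n - k}. ?s x = (if x \<le> k then 2 else 1))"
    by (simp only: if_bool_eq_conj) blast
  also have "\<dots> \<longleftrightarrow> column_family n k ?C"
    unfolding column_family_def by (rule arg_cong2[where f = "(\<and>)"]) blast+
  finally show ?thesis .
qed

lemma column_family_card:
  assumes "column_family n k C" and "2 * k \<le> 3 * n"
  shows "card (C 1) + card (C 2) + card (C 3) = 3 * n"
proof -
  let ?N = "3 * n - k"
  have "card (C c) = (\<Sum>x \<in> {1..?N}. of_bool (x \<in> C c))" if "c \<in> {1, 2, 3}" for c
  proof -
    have "{1..?N} \<inter> C c = C c" using assms(1) that by (auto simp: column_family_def)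
    then show ?thesis by (simp add: sum.If_cases of_bool_def Int_def)
  qed
  then have "card (C 1) + card (C 2) + card (C 3) =
      (\<Sum>x \<in> {1..?N}. of_bool (x \<in> C 1) + of_bool (x \<in> C 2) + of_bool (x \<in> C 3))"
    by (simp add: sum.distrib)
  also have "\<dots> = (\<Sum>x \<in> {1..?N}. if x \<le> k then 2 else 1)"
    using assms(1) unfolding column_family_def by (intro sum.cong refl) blast
  also have "\<dots> = (\<Sum>x \<in> {1..?N}. 1 + (if x \<in> {1..k} then 1 else 0))"
    by (intro sum.cong) auto
  also have "\<dots> = ?N + card ({1..?N} \<inter> {1..k})"
    unfolding sum.distrib by (subst sum.inter_restrict[symmetric]) auto
  also have "{1..?N} \<inter> {1..k} = {1..k}" using assms(2) by auto
  finally show ?thesis using assms(2) by simp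
qed

definition valid_tableau :: "nat \<Rightarrow> nat \<Rightarrow> tableau \<Rightarrow> bool" where
  "valid_tableau n k T \<longleftrightarrow> has_shape_3n n T \<and> semistandard T \<and> has_type n k T"

lemma valid_tableau_columns:
  assumes "valid_tableau n k T" and "2 * k \<le> 3 * n"
  shows "column_family n k (column_set T)" and "dominated n (column_set T)"
    and "c \<in> {1, 2, 3} \<Longrightarrow> column c T = sorted_list_of_set (column_set T c)"
proof -
  have shape: "has_shape_3n n T" and type: "has_type n k T" and semi: "semistandard T"
    using assms by (auto simp: valid_tableau_def)
  have sorted: "sorted_wrt (<) (column c T)" if "c \<in> {1, 2, 3}" for c
    using semi that unfolding semistandard_iff[OF shape] by blast
  then have dist: "\<forall>c \<in> {1, 2, 3}. distinct (column c T)"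
    by (meson strict_sorted_iff)
  show "column_family n k (column_set T)"
    using has_type_iff[OF shape dist assms(2)] type by simp
  have len: "length (column c T) = n" if "c \<in> {1, 2, 3}" for c
    using column_shape(1,3)[OF shape] that by simp
  show "dominated n (column_set T)"
    unfolding dominated_def column_set_def
    using semi[unfolded semistandard_iff[OF shape]] len
      pointwise_le_iff_card_greater[OF sorted[of 1] sorted[of 2]]
      pointwise_le_iff_card_greater[OF sorted[of 2] sorted[of 3]] dist
    by (auto simp: distinct_card)
  show "column c T = sorted_list_of_set (column_set T c)" if "c \<in> {1, 2, 3}"
    unfolding column_set_def
    using sorted[OF that] by (simp add: sorted_list_of_set.idem_if_sorted_distinct strict_sorted_iff)
qed

lemma tableau_of_column_family:
  assumes fam: "column_family n k C" and dom: "dominated n C" and nk: "2 * k \<le> 3 * n"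
  obtains T where "valid_tableau n k T" and "\<And>c. c \<in> {1, 2, 3} \<Longrightarrow> column_set T c = C c"
proof -
  define f where "f c = sorted_list_of_set (C c)" for c
  define T where "T = map (\<lambda>i. [f 1 ! i, f 2 ! i, f 3 ! i]) [0..<n]"
  have fin: "finite (C c)" if "c \<in> {1, 2, 3}" for c
    using fam that unfolding column_family_def by (meson finite_atLeastAtMost finite_subset)
  have len: "length (f c) = n" if "c \<in> {1, 2, 3}" for c
    using dom that by (simp add: f_def dominated_def) blast
  have shape: "has_shape_3n n T"
    by (simp add: has_shape_3n_def T_def comp_def map_replicate_const)
  have col: "column c T = f c" if "c \<in> {1, 2, 3}" for c
    unfolding column_shape(1)[OF shape that]
    by (rule nth_equalityI) (use len[OF that] that in \<open>auto simp: T_def\<close>)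
  have set: "column_set T c = C c" if "c \<in> {1, 2, 3}" for c
    using col[OF that] fin[OF that] by (simp add: column_set_def f_def)
  have sorted: "sorted_wrt (<) (column c T)" if "c \<in> {1, 2, 3}" for c
    using col[OF that] by (simp add: f_def)
  have sem: "semistandard T"
    unfolding semistandard_iff[OF shape]
    using sorted dom pointwise_le_iff_card_greater[OF sorted[of 1] sorted[of 2]]
      pointwise_le_iff_card_greater[OF sorted[of 2] sorted[of 3]]
      col len set
    by (auto simp: dominated_def column_set_def)
  have "column_family n k (column_set T)"
    using fam set by (simp add: column_family_def)
  moreover have "\<forall>c \<in> {1, 2, 3}. distinct (column c T)"
    using sorted by (meson strict_sorted_iff)
  ultimately have "has_type n k T" using has_type_iff[OF shape _ nk] by blast
  then have "valid_tableau n k T" using shape sem by (simp add: valid_tableau_def)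
  then show thesis using set that by blast
qed

section \<open>Words as families of columns\<close>

text \<open>
  For \<open>x > k\<close> the letter \<open>-r\<close> marks the column \<open>4 - r\<close> that contains \<open>x\<close>; for \<open>x \<le> k\<close> the letter \<open>r\<close> marks
  the column \<open>4 - r\<close> that omits it. Position \<open>q\<close> (from 0) of the word belongs to \<open>x = 3n - k - q\<close>, so
  the word runs through the entries of the tableau downwards.
\<close>
definition letter :: "nat \<Rightarrow> (nat \<Rightarrow> nat set) \<Rightarrow> nat \<Rightarrow> int" where
  "letter k C x =
     (if x \<le> k then if x \<notin> C 3 then 1 else if x \<notin> C 2 then 2 else 3
      else if x \<in> C 3 then - 1 else if x \<in> C 2 then - 2 else - 3)"

definition family_word :: "nat \<Rightarrow> nat \<Rightarrow> (nat \<Rightarrow> nat set) \<Rightarrow> int list" where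
  "family_word n k C = map (\<lambda>q. letter k C (3 * n - k - q)) [0..<3 * n - k]"

text \<open>Here \<open>int c - 4 = -r\<close> and \<open>4 - int c = r\<close> for the row \<open>r = 4 - c\<close> that belongs to column \<open>c\<close>.\<close>
definition word_family :: "int list \<Rightarrow> nat \<Rightarrow> nat set" where
  "word_family w c = {x \<in> {1..length w}.
     let a = w ! (length w - x) in if a < 0 then a = int c - 4 else a \<noteq> 4 - int c}"

lemma letter_in: "letter k C x \<in> letters"
  by (simp add: letter_def letters_def)

lemma sgn_letter: "sgn (letter k C x) = (if x \<le> k then 1 else - 1)"
  by (simp add: letter_def)

lemma sign_string_iff:
  assumes "2 * k \<le> 3 * n"
  shows "sign_string w = replicate (3 * n - 2 * k) (- 1) @ replicate k 1 \<longleftrightarrow>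
    length w = 3 * n - k \<and> (\<forall>q < 3 * n - k. sgn (w ! q) = (if 3 * n - k - q \<le> k then 1 else - 1))"
  (is "?l = ?r \<longleftrightarrow> _")
proof -
  have len: "3 * n - 2 * k + k = 3 * n - k" using assms by simp
  have "?r ! q = (if 3 * n - k - q \<le> k then 1 else - 1)" if "q < 3 * n - k" for q
    using that assms by (auto simp: nth_append)
  then show ?thesis
    unfolding list_eq_iff_nth_eq[of ?l ?r] using len by (auto simp: sign_string_def)
qed

lemma family_word_props:
  assumes "2 * k \<le> 3 * n"
  shows "length (family_word n k C) = 3 * n - k" and "set (family_word n k C) \<subseteq> letters"
    and "sign_string (family_word n k C) = replicate (3 * n - 2 * k) (- 1) @ replicate k 1"
  unfolding sign_string_iff[OF assms]
  using letter_in by (auto simp: family_word_def sgn_letter)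

lemma mem_column_iff_letter:
  assumes "column_family n k C" and "c \<in> {1, 2, 3}" and "x \<in> {1..3 * n - k}"
  shows "x \<in> C c \<longleftrightarrow> (if x \<le> k then letter k C x \<noteq> 4 - int c else letter k C x = int c - 4)"
proof -
  have "of_bool (x \<in> C 1) + of_bool (x \<in> C 2) + of_bool (x \<in> C 3) = (if x \<le> k then 2 else 1 :: nat)"
    using assms(1,3) unfolding column_family_def by blast
  then show ?thesis
    using assms(2)
    by (cases "x \<le> k"; cases "x \<in> C 1"; cases "x \<in> C 2"; cases "x \<in> C 3")
      (auto simp: letter_def)
qed

lemma word_family_inverse:
  assumes "column_family n k C" and "c \<in> {1, 2, 3}" and "2 * k \<le> 3 * n"
  shows "word_family (family_word n k C) c = C c"
proof -
  let ?w = "family_word n k C"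
  have nth: "?w ! (3 * n - k - x) = letter k C x" if "x \<in> {1..3 * n - k}" for x
  proof -
    have "3 * n - k - x < 3 * n - k" "3 * n - k - (3 * n - k - x) = x" using that by auto
    then show ?thesis by (simp add: family_word_def del: diff_diff_left)
  qed
  have "x \<in> word_family ?w c \<longleftrightarrow> x \<in> C c" if "x \<in> {1..3 * n - k}" for x
  proof -
    have "x \<in> word_family ?w c \<longleftrightarrow> (if letter k C x < 0 then letter k C x = int c - 4
        else letter k C x \<noteq> 4 - int c)"
      unfolding word_family_def mem_Collect_eq family_word_props(1)[OF assms(3)] nth[OF that] Let_def
      using that by blast
    moreover have "letter k C x < 0 \<longleftrightarrow> \<not> x \<le> k" by (simp add: letter_def)
    ultimately show ?thesis unfolding mem_column_iff_letter[OF assms(1,2) that] by simp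
  qed
  moreover have "C c \<subseteq> {1..3 * n - k}" using assms(1,2) by (auto simp: column_family_def)
  moreover have "word_family ?w c \<subseteq> {1..3 * n - k}"
    by (auto simp: word_family_def family_word_props(1)[OF assms(3)])
  ultimately show ?thesis by blast
qed

lemma family_word_inverse:
  assumes "set w \<subseteq> letters" and nk: "2 * k \<le> 3 * n"
    and sgn: "sign_string w = replicate (3 * n - 2 * k) (- 1) @ replicate k 1"
  shows "column_family n k (word_family w)" and "family_word n k (word_family w) = w"
proof -
  let ?N = "3 * n - k"
  have len: "length w = ?N" using sgn unfolding sign_string_iff[OF nk] by simp
  have mem: "(w ! (?N - x) \<in> (if x \<le> k then {1, 2, 3} else {-1, -2, -3})) \<and>
      (\<forall>c. x \<in> word_family w c \<longleftrightarrow>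
        (if x \<le> k then w ! (?N - x) \<noteq> 4 - int c else w ! (?N - x) = int c - 4))"
    if x: "x \<in> {1..?N}" for x
  proof -
    have q: "?N - x < ?N" "?N - (?N - x) = x" using x by auto
    then have "sgn (w ! (?N - x)) = (if x \<le> k then 1 else - 1)"
      using sgn unfolding sign_string_iff[OF nk] by metis
    moreover have "w ! (?N - x) \<in> letters" using assms(1) len q nth_mem by (metis subsetD)
    ultimately show ?thesis using x len
      by (auto simp: word_family_def letters_def split: if_splits)
  qed
  show "column_family n k (word_family w)"
    unfolding column_family_def
  proof (intro conjI ballI)
    show "word_family w c \<subseteq> {1..?N}" for c using len by (auto simp: word_family_def)
    show "of_bool (x \<in> word_family w 1) + of_bool (x \<in> word_family w 2) +
        of_bool (x \<in> word_family w 3) = (if x \<le> k then 2 else 1 :: nat)" if "x \<in> {1..?N}" for x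
      using mem[OF that] by (auto split: if_splits)
  qed
  show "family_word n k (word_family w) = w"
  proof (rule nth_equalityI)
    show "length (family_word n k (word_family w)) = length w"
      using len by (simp add: family_word_def)
    fix q assume "q < length (family_word n k (word_family w))"
    then have q: "q < ?N" by (simp add: family_word_def)
    then have "?N - q \<in> {1..?N}" "?N - (?N - q) = q" by auto
    then show "family_word n k (word_family w) ! q = w ! q"
      using mem[of "?N - q"] q by (auto simp: family_word_def letter_def split: if_splits)
  qed
qed

lemma row_of_eqI:
  assumes "length P = 3" and "\<And>r. r \<in> {1, 2, 3} \<Longrightarrow> i \<in> set (P ! (r - 1)) \<longleftrightarrow> r = s"
    and "s \<in> {1, 2, 3}"
  shows "row_of P i = s"
proof -
  have "1 \<le> r \<and> r \<le> length P \<longleftrightarrow> r \<in> {1, 2, 3}" for r using assms(1) by auto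
  then show ?thesis unfolding row_of_def using assms(2,3) by (intro the_equality) auto
qed

text \<open>
  The shift \<open>x \<mapsto> 3n - k + 1 - x\<close> in \<open>T\<^sup>-\<close> and the reversal of the plus part of the word have the same
  effect: the letter at 0-based position \<open>q\<close> depends on the single value \<open>3n - k - q\<close>, which is
  looked up in \<open>T\<^sup>-\<close> when it exceeds \<open>k\<close> and in \<open>T\<^sup>+\<close> otherwise.
\<close>
lemma pair_word_eq:
  assumes ok: "valid_tableau n k T" and nk: "2 * k \<le> 3 * n"
  shows "pair_word n k (T_plus k T, T_minus n k T) = family_word n k (column_set T)"
    (is "?v = ?w")
proof (rule nth_equalityI)
  let ?N = "3 * n - k" and ?C = "column_set T"
  note fam = valid_tableau_columns(1)[OF ok nk]
  show len: "length ?v = length ?w"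
    using nk by (simp add: pair_word_def family_word_def del: upt_Suc)
  fix q assume "q < length ?v"
  then have q: "q < ?N" unfolding len by (simp add: family_word_def)
  let ?x = "?N - q"
  have x: "?x \<in> {1..?N}" using q by auto
  have w: "?w ! q = letter k ?C ?x" using q by (simp add: family_word_def)
  note mem = mem_column_iff_letter[OF fam _ x]
  have rows: "T_plus k T ! (r - 1) = filter (\<lambda>x. x \<notin> set (column1 k (4 - r) T)) [1..<Suc k]"
    "T_minus n k T ! (r - 1) = sort (map (\<lambda>x. ?N + 1 - x) (column2 k (4 - r) T))"
    if "r \<in> {1, 2, 3}" for r
    using that by (auto simp: T_plus_def T_minus_def)
  show "?v ! q = ?w ! q"
  proof (cases "?x \<le> k")
    case True
    have "row_of (T_plus k T) ?x = nat (letter k ?C ?x)"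
    proof (rule row_of_eqI)
      show "nat (letter k ?C ?x) \<in> {1, 2, 3}" using True by (simp add: letter_def)
      fix r :: nat assume r: "r \<in> {1, 2, 3}"
      have "?x \<in> set (T_plus k T ! (r - 1)) \<longleftrightarrow> ?x \<notin> ?C (4 - r)"
        unfolding rows[OF r] using True x
        by (auto simp: column1_def column_set_def simp del: upt_Suc)
      also have "\<dots> \<longleftrightarrow> letter k ?C ?x = int r"
        using mem[of "4 - r"] True r by auto
      also have "\<dots> \<longleftrightarrow> r = nat (letter k ?C ?x)"
        using True by (auto simp: letter_def)
      finally show "?x \<in> set (T_plus k T ! (r - 1)) \<longleftrightarrow> r = nat (letter k ?C ?x)" .
    qed (simp add: T_plus_def)
    moreover have "0 \<le> letter k ?C ?x" using True by (simp add: letter_def)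
    moreover have "?v ! q = int (row_of (T_plus k T) ?x)"
    proof -
      have "\<not> q < 3 * n - 2 * k" "k - Suc (q - (3 * n - 2 * k)) + 1 = ?x"
        using True q nk by auto
      then show ?thesis using True q nk
        by (simp add: pair_word_def nth_append rev_nth del: upt_Suc)
    qed
    ultimately show ?thesis using w by simp
  next
    case False
    then have q': "q < 3 * n - 2 * k" by auto
    have "row_of (T_minus n k T) (q + 1) = nat (- letter k ?C ?x)"
    proof (rule row_of_eqI)
      show "nat (- letter k ?C ?x) \<in> {1, 2, 3}" using False by (simp add: letter_def)
      fix r :: nat assume r: "r \<in> {1, 2, 3}"
      have "4 - r \<in> {1, 2, 3}" using r by auto
      then have "?C (4 - r) \<subseteq> {1..?N}" using fam unfolding column_family_def by blast
      then have "q + 1 = ?N + 1 - y \<longleftrightarrow> y = ?x" if "y \<in> ?C (4 - r)" for y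
        using that q by auto
      then have "q + 1 \<in> set (T_minus n k T ! (r - 1)) \<longleftrightarrow> (\<exists>y \<in> ?C (4 - r). k < y \<and> y = ?x)"
        unfolding rows[OF r] by (auto simp: column2_def column_set_def image_iff Bex_def)
      also have "\<dots> \<longleftrightarrow> ?x \<in> ?C (4 - r)" using False by auto
      also have "\<dots> \<longleftrightarrow> - letter k ?C ?x = int r"
        using mem[of "4 - r"] False r by auto
      also have "\<dots> \<longleftrightarrow> r = nat (- letter k ?C ?x)"
        using False by (auto simp: letter_def)
      finally show "q + 1 \<in> set (T_minus n k T ! (r - 1)) \<longleftrightarrow> r = nat (- letter k ?C ?x)" .
    qed (simp add: T_minus_def)
    moreover have "letter k ?C ?x \<le> 0" using False by (simp add: letter_def)
    moreover have "?v ! q = - int (row_of (T_minus n k T) (q + 1))"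
      using q' by (simp add: pair_word_def nth_append del: upt_Suc)
    ultimately show ?thesis using w by simp
  qed
qed

section \<open>Balance is dominance\<close>

text \<open>
  Letter by letter: \<open>-1\<close>, \<open>-2\<close>, \<open>-3\<close> put \<open>x\<close> into column 3, 2, 1 and act on the colours as open 1, close
  1 and open 2, close 2. The letters \<open>3\<close>, \<open>2\<close>, \<open>1\<close> omit \<open>x\<close> from column 1, 2, 3 and act as open 2,
  close 2 and open 1, close 1. In each case the change of the two heights is the change of the two
  differences of column counts.
\<close>
lemma height_family_word:
  assumes fam: "column_family n k C" and m: "m \<le> 3 * n - k"
  defines "D \<equiv> \<lambda>c. int (card {y \<in> C c. 3 * n - k - m < y})"
  shows "height (family_word n k C) 1 m = D 3 - D 2"
    and "height (family_word n k C) 2 m = D 2 - D 1"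
proof -
  let ?N = "3 * n - k" and ?w = "family_word n k C"
  have "height ?w 1 m = int (card {y \<in> C 3. ?N - m < y}) - int (card {y \<in> C 2. ?N - m < y}) \<and>
      height ?w 2 m = int (card {y \<in> C 2. ?N - m < y}) - int (card {y \<in> C 1. ?N - m < y})"
    using m
  proof (induction m)
    case 0
    have "{y \<in> C c. ?N < y} = {}" if "c \<in> {1, 2, 3}" for c
      using fam that by (fastforce simp: column_family_def)
    then have "card {y \<in> C c. ?N < y} = 0" if "c \<in> {1, 2, 3}" for c
      using that by (metis card.empty)
    then show ?case by (simp add: height_def)
  next
    case (Suc m)
    let ?x = "?N - m"
    have x: "?x \<in> {1..?N}" using Suc.prems by auto
    have step: "int (card {y \<in> C c. ?N - Suc m < y}) = int (card {y \<in> C c. ?x < y}) + of_bool (?x \<in> C c)"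
      if "c \<in> {1, 2, 3}" for c
    proof -
      have "finite (C c)"
        using fam that unfolding column_family_def by (meson finite_atLeastAtMost finite_subset)
      moreover have "{y \<in> C c. ?N - Suc m < y} =
          (if ?x \<in> C c then insert ?x {y \<in> C c. ?x < y} else {y \<in> C c. ?x < y})"
        using Suc.prems
        by (auto simp del: diff_diff_left)
          (metis Suc_diff_Suc Suc_le_lessD less_antisym not_less_eq)+
      ultimately show ?thesis by simp
    qed
    have w: "?w ! m = letter k C ?x" using Suc.prems by (simp add: family_word_def)
    have "of_bool (triangle_right (?w ! m) = 1) - of_bool (triangle_left (?w ! m) = 1) =
        (of_bool (?x \<in> C 3) - of_bool (?x \<in> C 2) :: int) \<and>
      of_bool (triangle_right (?w ! m) = 2) - of_bool (triangle_left (?w ! m) = 2) =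
        (of_bool (?x \<in> C 2) - of_bool (?x \<in> C 1) :: int)"
    proof -
      have "of_bool (?x \<in> C 1) + of_bool (?x \<in> C 2) + of_bool (?x \<in> C 3) =
          (if ?x \<le> k then 2 else 1 :: nat)"
        using fam x unfolding column_family_def by blast
      then show ?thesis
        unfolding w letter_def
        by (cases "?x \<le> k"; cases "?x \<in> C 1"; cases "?x \<in> C 2"; cases "?x \<in> C 3")
          (simp_all add: triangle_left_def triangle_right_def)
    qed
    then show ?case using Suc step[of 1] step[of 2] step[of 3] by (simp add: height_def)
  qed
  then show "height ?w 1 m = D 3 - D 2" and "height ?w 2 m = D 2 - D 1"
    by (simp_all add: D_def)
qed

text \<open>
  At the end of the word the heights compare the full sizes of the columns. Equal sizes are then forced to
  be \<open>n\<close>, since the family has \<open>3n\<close> entries counted with multiplicity.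
\<close>
lemma admissible_iff_dominated:
  assumes fam: "column_family n k C" and nk: "2 * k \<le> 3 * n"
  shows "admissible (family_word n k C) \<longleftrightarrow> dominated n C"
proof -
  let ?N = "3 * n - k" and ?w = "family_word n k C"
  define D where "D c x = card {y \<in> C c. x < y}" for c x
  have "height ?w 1 m = int (D 3 (?N - m)) - int (D 2 (?N - m))"
    "height ?w 2 m = int (D 2 (?N - m)) - int (D 1 (?N - m))" if "m \<le> ?N" for m
    unfolding D_def using height_family_word[OF fam that] by auto
  moreover have "D c 0 = card (C c)" if "c \<in> {1, 2, 3}" for c
  proof -
    have "{y \<in> C c. 0 < y} = C c" using fam that by (fastforce simp: column_family_def)
    then show ?thesis by (simp add: D_def)
  qed
  moreover have "(d \<noteq> 0) = (d = 1 \<or> d = 2)" for d :: 3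
    using exhaust_mod3[of d] by auto
  ultimately have "admissible ?w \<longleftrightarrow>
     (\<forall>m \<le> ?N. D 2 (?N - m) \<le> D 3 (?N - m) \<and> D 1 (?N - m) \<le> D 2 (?N - m)) \<and>
     card (C 3) = card (C 2) \<and> card (C 2) = card (C 1)"
    unfolding admissible_iff_height[OF family_word_props(2)[OF nk]] family_word_props(1)[OF nk]
    by (auto simp: all_conj_distrib imp_conjR)
  also have "(\<forall>m \<le> ?N. D 2 (?N - m) \<le> D 3 (?N - m) \<and> D 1 (?N - m) \<le> D 2 (?N - m)) \<longleftrightarrow>
     (\<forall>x. D 2 x \<le> D 3 x \<and> D 1 x \<le> D 2 x)" (is "?l \<longleftrightarrow> ?r")
  proof
    assume ?l
    show ?r
    proof
      fix x
      show "D 2 x \<le> D 3 x \<and> D 1 x \<le> D 2 x"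
      proof (cases "x \<le> ?N")
        case True
        then have "?N - (?N - x) = x" by simp
        then show ?thesis using \<open>?l\<close> diff_le_self by metis
      next
        case False
        then have "{y \<in> C c. x < y} = {}" if "c \<in> {1, 2, 3}" for c
          using fam that by (fastforce simp: column_family_def)
        then have "D c x = 0" if "c \<in> {1, 2, 3}" for c using that by (metis D_def card.empty)
        then show ?thesis by simp
      qed
    qed
  qed blast
  also have "\<dots> \<and> card (C 3) = card (C 2) \<and> card (C 2) = card (C 1) \<longleftrightarrow> dominated n C"
    using column_family_card[OF fam nk] by (auto simp: dominated_def D_def)
  finally show ?thesis .
qed

section \<open>The bijection\<close>

theorem mainTheorem3:
  fixes n k :: nat
  assumes "n \<ge> 1" and "2 * k \<le> 3 * n"
  shows "(\<forall>p \<in> tableau_pairs n k. admissible (pair_word n k p)) \<and>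
    bij_betw (\<lambda>p. flow_diagram (pair_word n k p)) (tableau_pairs n k) (admissible_diagrams n k)"
proof (intro conjI ballI)
  note nk = assms(2)
  let ?pair = "\<lambda>T. (T_plus k T, T_minus n k T)"
  have pairs: "tableau_pairs n k = ?pair ` {T. valid_tableau n k T}"
    by (auto simp: tableau_pairs_def valid_tableau_def)
  have adm: "admissible (family_word n k (column_set T))" if "valid_tableau n k T" for T
    using valid_tableau_columns[OF that nk] admissible_iff_dominated[OF _ nk] by blast
  then show "admissible (pair_word n k p)" if "p \<in> tableau_pairs n k" for p
    using that by (auto simp: pairs pair_word_eq nk)
  show "bij_betw (\<lambda>p. flow_diagram (pair_word n k p)) (tableau_pairs n k) (admissible_diagrams n k)"
  proof (rule bij_betw_imageI)
    show "inj_on (\<lambda>p. flow_diagram (pair_word n k p)) (tableau_pairs n k)"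
      unfolding pairs
    proof (rule inj_onI, clarify)
      fix T T' assume ok: "valid_tableau n k T" "valid_tableau n k T'"
        and "flow_diagram (pair_word n k (?pair T)) = flow_diagram (pair_word n k (?pair T'))"
      then have eq: "family_word n k (column_set T) = family_word n k (column_set T')"
        by (intro flow_diagram_inj) (simp_all add: pair_word_eq nk family_word_props)
      \<comment> \<open>\<open>T\<^sup>+\<close> and \<open>T\<^sup>-\<close> depend only on the columns of \<open>T\<close>, and these are the sorted column sets.\<close>
      have "column c T = column c T'" if c: "c \<in> {1, 2, 3}" for c
      proof -
        have "column_set T c = column_set T' c"
          using word_family_inverse[OF valid_tableau_columns(1)[OF ok(1) nk] c nk]
            word_family_inverse[OF valid_tableau_columns(1)[OF ok(2) nk] c nk] eq by simp
        then show ?thesis using valid_tableau_columns(3)[OF _ nk c] ok by simp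
      qed
      then show "T_plus k T = T_plus k T' \<and> T_minus n k T = T_minus n k T'"
        by (simp add: T_plus_def T_minus_def column1_def column2_def)
    qed
    show "(\<lambda>p. flow_diagram (pair_word n k p)) ` tableau_pairs n k = admissible_diagrams n k"
    proof (intro equalityI subsetI)
      fix d assume "d \<in> (\<lambda>p. flow_diagram (pair_word n k p)) ` tableau_pairs n k"
      then obtain T where "valid_tableau n k T" "d = flow_diagram (family_word n k (column_set T))"
        by (auto simp: pairs pair_word_eq nk)
      then show "d \<in> admissible_diagrams n k"
        unfolding admissible_diagrams_def using family_word_props[OF nk] adm by blast
    next
      fix d assume "d \<in> admissible_diagrams n k"
      then obtain w where d: "d = flow_diagram w" and w: "set w \<subseteq> letters"
        "sign_string w = replicate (3 * n - 2 * k) (- 1) @ replicate k 1" "admissible w"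
        unfolding admissible_diagrams_def by blast
      note fam = family_word_inverse[OF w(1) nk w(2)]
      then have "dominated n (word_family w)"
        using admissible_iff_dominated[OF fam(1) nk] w(3) by simp
      then obtain T where T: "valid_tableau n k T"
        "\<And>c. c \<in> {1, 2, 3} \<Longrightarrow> column_set T c = word_family w c"
        using tableau_of_column_family[OF fam(1) _ nk] by blast
      have "family_word n k (column_set T) = family_word n k (word_family w)"
        using T(2) by (simp add: family_word_def letter_def)
      then have "pair_word n k (?pair T) = w" using fam(2) pair_word_eq[OF T(1) nk] by simp
      then show "d \<in> (\<lambda>p. flow_diagram (pair_word n k p)) ` tableau_pairs n k"
        unfolding pairs d using T(1) by force
    qed
  qed
qed

end
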